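(* Let $(X_n)_{n\ge 0}$ be the nearest neighbour walk on $\{0,1,2,\dots\}$ with parameters $(p_i)_{i\ge 1}$ described in the context, and assume that it is transient. Assume that $p_R\to 0$ as $R\to\infty$. Then the following hold. (1) With probability $1$, for any $\varepsilon>0$, $$\xi(R,\infty)\le 2(1+\varepsilon)\,D(R,\infty)\log R$$ for all sufficiently large $R$. (2) For any $M>0$, with probability $1$, $$\xi(R,\infty)\ge M\,D(R,\infty)\quad\text{for infinitely many } R.$$
   Context: Let $0\le p_i<1/2$ for $i=1,2,\dots$. $(X_n)_{n\ge0}$ is the Markov chain on $\{0,1,2,\dots\}$ with $X_0=0$ and $\mathbf P(X_{n+1}=i+1\mid X_n=i)=1-\mathbf P(X_{n+1}=i-1\mid X_n=i)=E_i$, where $E_0=1$ and $E_i=1/2+p_i$ for $i\ge 1$. The local time is $\xi(x,n)=\#\{k:0\le k\le n,\ X_k=x\}$ and $\xi(x,\infty)=\lim_{n\to\infty}\xi(x,n)$, for $x=0,1,2,\dots$. Put $U_i=\frac{1-E_i}{E_i}=\frac{1/2-p_i}{1/2+p_i}$ for $i\ge1$ and, for $m\ge 0$, $$D(m,\infty)=1+\sum_{j=1}^{\infty}\prod_{i=1}^{j}U_{m+i}.$$ *)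

theory Defs
  imports "HOL-Probability.Probability"
begin

definition up_prob :: "(nat \<Rightarrow> real) \<Rightarrow> nat \<Rightarrow> real" where
  "up_prob p i = (if i = 0 then 1 else 1/2 + p i)"

text \<open>
  The Markov property is stated with respect to the whole past (conditioning on the
  initial path \<open>s 0, \<dots>, s n\<close> whenever it has positive probability).
  The down-step event is written \<open>Suc (X (Suc n) \<omega>) = s n\<close> to avoid truncated
  subtraction; for \<open>s n = 0\<close> it is empty, in accordance with \<open>up_prob p 0 = 1\<close>.
\<close>

locale nn_walk = prob_space M
  for M :: "'a measure" and p :: "nat \<Rightarrow> real" and X :: "nat \<Rightarrow> 'a \<Rightarrow> nat" +
  assumes p_range: "\<And>i. 1 \<le> i \<Longrightarrow> 0 \<le> p i \<and> p i < 1/2"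
    and X_measurable: "\<And>n. X n \<in> measurable M (count_space UNIV)"
    and X_0: "AE \<omega> in M. X 0 \<omega> = 0"
    and step_up: "\<And>n s. \<P>(\<omega> in M. \<forall>k\<le>n. X k \<omega> = s k) > 0 \<Longrightarrow>
      \<P>(\<omega> in M. X (Suc n) \<omega> = Suc (s n) \<bar> \<forall>k\<le>n. X k \<omega> = s k) = up_prob p (s n)"
    and step_down: "\<And>n s. \<P>(\<omega> in M. \<forall>k\<le>n. X k \<omega> = s k) > 0 \<Longrightarrow>
      \<P>(\<omega> in M. Suc (X (Suc n) \<omega>) = s n \<bar> \<forall>k\<le>n. X k \<omega> = s k) = 1 - up_prob p (s n)"

text \<open>
  A state is transient if, from a visit to it, the chain returns with probability less
  than one. Only one starting point is at hand, so the chain started at \<open>x\<close> is realised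
  by conditioning on \<open>X m = x\<close>; by time homogeneity the choice of \<open>m\<close> is immaterial.
\<close>

definition transient_state :: "'a measure \<Rightarrow> (nat \<Rightarrow> 'a \<Rightarrow> nat) \<Rightarrow> nat \<Rightarrow> bool" where
  "transient_state M X x \<longleftrightarrow>
     (\<forall>m. \<P>(\<omega> in M. X m \<omega> = x) > 0 \<longrightarrow>
          \<P>(\<omega> in M. \<exists>n>m. X n \<omega> = x \<bar> X m \<omega> = x) < 1)"

definition transient_walk :: "'a measure \<Rightarrow> (nat \<Rightarrow> 'a \<Rightarrow> nat) \<Rightarrow> bool" where
  "transient_walk M X \<longleftrightarrow> (\<forall>x. transient_state M X x)"

definition local_time :: "(nat \<Rightarrow> 'a \<Rightarrow> nat) \<Rightarrow> nat \<Rightarrow> nat \<Rightarrow> 'a \<Rightarrow> nat" where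
  "local_time X x n \<omega> = card {k. k \<le> n \<and> X k \<omega> = x}"

definition total_local_time :: "(nat \<Rightarrow> 'a \<Rightarrow> nat) \<Rightarrow> nat \<Rightarrow> 'a \<Rightarrow> ereal" where
  "total_local_time X x \<omega> = lim (\<lambda>n. ereal (real (local_time X x n \<omega>)))"

definition U_ratio :: "(nat \<Rightarrow> real) \<Rightarrow> nat \<Rightarrow> real" where
  "U_ratio p i = (1 - up_prob p i) / up_prob p i"

text \<open>The series has nonnegative terms, so its \<^typ>\<open>ereal\<close> value is meaningful even when it
  diverges. The index is shifted by one: the term of index \<open>j\<close> is the product over
  \<open>1, \<dots>, j + 1\<close>.\<close>

definition D_inf :: "(nat \<Rightarrow> real) \<Rightarrow> nat \<Rightarrow> ereal" where
  "D_inf p m = 1 + (\<Sum>j. ereal (\<Prod>i=1..Suc j. U_ratio p (m + i)))"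

end

theory Submission imports Defs begin

text \<open>
  Transience forces \<open>D(R) < \<infinity>\<close>: the probability of avoiding \<open>0\<close> forever is a bounded function of
  the starting point, harmonic off \<open>0\<close>, and such a function is a multiple of
  \<open>x \<mapsto> \<Sum>j<x. \<Prod>i=1..j. U i\<close>. Consequently \<open>\<xi>(R,\<infinity>)\<close> is geometric with return probability
  \<open>1 - E R / D(R)\<close>, where \<open>1/2 \<le> E R \<le> 1\<close>; the strong Markov property is replaced by a bounded
  martingale, the conditional probability of at least \<open>N\<close> visits to \<open>R\<close> given the past.
  The upper bound is the first Borel--Cantelli lemma. For the lower bound, \<open>p \<rightarrow> 0\<close> gives
  \<open>D(R) \<ge> 2\<close> eventually, so every unvisited high level gets \<open>K D(R)\<close> visits with conditional
  probability at least \<open>exp (-2 K)\<close> whatever the past.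
\<close>

subsection \<open>One-step analysis\<close>

text \<open>The latest state comes first, so that a step of the walk is a cons. There are only
  countably many lists, so every function of the past is measurable for free.\<close>

primrec hist :: "(nat \<Rightarrow> 'a \<Rightarrow> nat) \<Rightarrow> nat \<Rightarrow> 'a \<Rightarrow> nat list" where
  "hist X 0 \<omega> = [X 0 \<omega>]"
| "hist X (Suc n) \<omega> = X (Suc n) \<omega> # hist X n \<omega>"

lemma length_hist [simp]: "length (hist X n \<omega>) = Suc n"
  by (induction n) auto

lemma hd_hist [simp]: "hd (hist X n \<omega>) = X n \<omega>"
  by (cases n) auto

lemma hist_neq_Nil [simp]: "hist X n \<omega> \<noteq> []"
  by (cases n) auto

lemma drop_hist: "drop k (hist X (n + k) \<omega>) = hist X n \<omega>"
  by (induction k) auto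

lemma hist_eq_iff:
  "hist X n \<omega> = l \<longleftrightarrow> length l = Suc n \<and> (\<forall>k\<le>n. X k \<omega> = l ! (n - k))"
proof (induction n arbitrary: l)
  case 0
  then show ?case by (cases l) auto
next
  case (Suc n)
  show ?case
  proof (cases l)
    case (Cons y l')
    have "(\<forall>k\<le>Suc n. X k \<omega> = l ! (Suc n - k)) \<longleftrightarrow>
          X (Suc n) \<omega> = y \<and> (\<forall>k\<le>n. X k \<omega> = l' ! (n - k))"
      unfolding le_Suc_eq Cons by (auto simp: Suc_diff_le)
    then show ?thesis using Suc[of l'] by (auto simp: Cons)
  qed simp
qed

lemma local_time_eq_count_list: "local_time X x n \<omega> = count_list (hist X n \<omega>) x"
proof (induction n)
  case 0
  have "{k. k \<le> (0::nat) \<and> X k \<omega> = x} = (if X 0 \<omega> = x then {0} else {})"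
    by auto
  then show ?case by (auto simp: local_time_def)
next
  case (Suc n)
  have "{k. k \<le> Suc n \<and> X k \<omega> = x} =
      (if X (Suc n) \<omega> = x then insert (Suc n) {k. k \<le> n \<and> X k \<omega> = x} else {k. k \<le> n \<and> X k \<omega> = x})"
    by (auto simp: le_Suc_eq)
  then show ?case using Suc by (auto simp: local_time_def)
qed

lemma local_time_mono: "m \<le> n \<Longrightarrow> local_time X x m \<omega> \<le> local_time X x n \<omega>"
  unfolding local_time_def by (intro card_mono) auto

lemma total_local_time_eq_SUP:
  "total_local_time X x \<omega> = (SUP n. ereal (real (local_time X x n \<omega>)))"
  unfolding total_local_time_def
  by (intro limI LIMSEQ_SUP) (auto simp: incseq_def local_time_mono)

section \<open>Path probabilities and one-step expectations\<close>

context nn_walk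
begin

lemma hist_measurable [measurable]: "hist X n \<in> measurable M (count_space UNIV)"
proof (induction n)
  case 0
  note X_measurable[measurable]
  show ?case unfolding hist.simps by measurable
next
  case (Suc n)
  note X_measurable[measurable] Suc[measurable]
  have "(\<lambda>\<omega>. X (Suc n) \<omega> # hist X n \<omega>) \<in> measurable M (count_space UNIV)"
    by (rule measurable_compose_countable[where f="\<lambda>l \<omega>. X (Suc n) \<omega> # l" and g="hist X n"]) measurable
  then show ?case by simp
qed

lemma X_measurable' [measurable]: "X n \<in> measurable M (count_space UNIV)"
  by (rule X_measurable)

lemma local_time_measurable [measurable]: "local_time X x n \<in> measurable M (count_space UNIV)"
  unfolding local_time_eq_count_list[abs_def] by measurable

text \<open>Product form of the transition assumptions: on a path of probability zero both sides
  vanish, so no positivity condition has to be carried along.\<close>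

lemma prob_hist_up:
  "\<P>(\<omega> in M. hist X n \<omega> = l \<and> X (Suc n) \<omega> = Suc (hd l)) =
     up_prob p (hd l) * \<P>(\<omega> in M. hist X n \<omega> = l)"
  and prob_hist_down:
  "\<P>(\<omega> in M. hist X n \<omega> = l \<and> Suc (X (Suc n) \<omega>) = hd l) =
     (1 - up_prob p (hd l)) * \<P>(\<omega> in M. hist X n \<omega> = l)"
proof -
  let ?P = "\<P>(\<omega> in M. hist X n \<omega> = l)"
  have *: "\<P>(\<omega> in M. hist X n \<omega> = l \<and> Q \<omega>) = 0" if "?P = 0" for Q
  proof -
    have "\<P>(\<omega> in M. hist X n \<omega> = l \<and> Q \<omega>) \<le> ?P"
      by (intro finite_measure_mono) auto
    then show ?thesis using that by (simp add: measure_le_0_iff)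
  qed
  \<comment> \<open>Histories run backwards in time, hence the reversed index.\<close>
  define s where "s k = l ! (n - k)" for k
  have eq: "(\<forall>k\<le>n. X k \<omega> = s k) \<longleftrightarrow> hist X n \<omega> = l" if "?P \<noteq> 0" for \<omega>
  proof -
    have "length l = Suc n"
    proof (rule ccontr)
      assume "length l \<noteq> Suc n"
      then have "{\<omega> \<in> space M. hist X n \<omega> = l} = {}" by auto
      with that show False by (metis measure_empty)
    qed
    then show ?thesis by (simp add: hist_eq_iff s_def)
  qed
  have sn: "s n = hd l" if "?P \<noteq> 0"
  proof -
    have "l \<noteq> []"
      using that by (auto intro: ccontr)
    then show ?thesis by (simp add: s_def hd_conv_nth)
  qed
  show "\<P>(\<omega> in M. hist X n \<omega> = l \<and> X (Suc n) \<omega> = Suc (hd l)) = up_prob p (hd l) * ?P"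
  proof (cases "?P = 0")
    case False
    then have "?P > 0" by (simp add: zero_less_measure_iff)
    then show ?thesis
      using step_up[of n s] False by (simp add: eq sn cond_prob_def field_simps conj_commute)
  qed (simp add: *)
  show "\<P>(\<omega> in M. hist X n \<omega> = l \<and> Suc (X (Suc n) \<omega>) = hd l) = (1 - up_prob p (hd l)) * ?P"
  proof (cases "?P = 0")
    case False
    then have "?P > 0" by (simp add: zero_less_measure_iff)
    then show ?thesis
      using step_down[of n s] False by (simp add: eq sn cond_prob_def field_simps conj_commute)
  qed (simp add: *)
qed

text \<open>After each of the countably many paths the two step probabilities add up to 1, so any
  other step has probability zero.\<close>

lemma AE_step: "AE \<omega> in M. X (Suc n) \<omega> = Suc (X n \<omega>) \<or> Suc (X (Suc n) \<omega>) = X n \<omega>"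
proof -
  have "AE \<omega> in M. \<forall>l. hist X n \<omega> = l \<longrightarrow> X (Suc n) \<omega> = Suc (hd l) \<or> Suc (X (Suc n) \<omega>) = hd l"
  proof (subst AE_all_countable, rule allI)
    fix l
    let ?U = "{\<omega> \<in> space M. hist X n \<omega> = l \<and> X (Suc n) \<omega> = Suc (hd l)}"
    let ?V = "{\<omega> \<in> space M. hist X n \<omega> = l \<and> Suc (X (Suc n) \<omega>) = hd l}"
    let ?A = "{\<omega> \<in> space M. hist X n \<omega> = l}"
    have "prob (?A - (?U \<union> ?V)) = prob ?A - prob (?U \<union> ?V)"
      by (intro finite_measure_Diff) auto
    also have "prob (?U \<union> ?V) = prob ?U + prob ?V"
      by (intro finite_measure_Union) auto
    finally have "prob (?A - (?U \<union> ?V)) = 0"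
      by (simp add: prob_hist_up prob_hist_down algebra_simps)
    then have "AE \<omega> in M. \<omega> \<notin> ?A - (?U \<union> ?V)"
      by (subst (asm) prob_eq_0) auto
    then show "AE \<omega> in M. hist X n \<omega> = l \<longrightarrow> X (Suc n) \<omega> = Suc (hd l) \<or> Suc (X (Suc n) \<omega>) = hd l"
      using AE_space by eventually_elim auto
  qed
  then show ?thesis by eventually_elim auto
qed

text \<open>A walk from 0 climbs at most one level per step, so this finite set carries the law of
  the first \<open>n\<close> steps, and expectations become finite sums.\<close>

definition paths :: "nat \<Rightarrow> nat list set" where
  "paths n = {l. set l \<subseteq> {..n} \<and> length l = Suc n}"

lemma finite_paths: "finite (paths n)"
  unfolding paths_def by (rule finite_lists_length_eq) simp

lemma AE_hist_in_paths: "AE \<omega> in M. hist X n \<omega> \<in> paths n"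
proof (induction n)
  case 0
  show ?case using X_0 by eventually_elim (auto simp: paths_def)
next
  case (Suc n)
  show ?case using Suc AE_step[of n]
  proof eventually_elim
    case (elim \<omega>)
    then have "X n \<omega> \<le> n"
      by (metis (no_types, lifting) atMost_iff hd_hist hd_in_set hist_neq_Nil mem_Collect_eq paths_def subsetD)
    with elim show ?case by (auto simp: paths_def le_Suc_eq)
  qed
qed

lemma expectation_hist:
  fixes f :: "nat list \<Rightarrow> real"
  shows "integrable M (\<lambda>\<omega>. f (hist X n \<omega>))" (is ?I)
    and "expectation (\<lambda>\<omega>. f (hist X n \<omega>)) = (\<Sum>l\<in>paths n. f l * \<P>(\<omega> in M. hist X n \<omega> = l))" (is ?E)
proof -
  let ?g = "\<lambda>\<omega>. \<Sum>l\<in>paths n. f l * indicator {\<omega> \<in> space M. hist X n \<omega> = l} \<omega>"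
  have ae: "AE \<omega> in M. ?g \<omega> = f (hist X n \<omega>)"
    using AE_hist_in_paths[of n] AE_space
  proof eventually_elim
    case (elim \<omega>)
    have "?g \<omega> = (\<Sum>l\<in>paths n. if l = hist X n \<omega> then f l else 0)"
      using elim by (intro sum.cong) (auto split: split_indicator)
    also have "\<dots> = f (hist X n \<omega>)" using elim by (simp add: finite_paths)
    finally show ?case .
  qed
  have int: "has_bochner_integral M ?g (\<Sum>l\<in>paths n. f l * \<P>(\<omega> in M. hist X n \<omega> = l))"
    by (intro has_bochner_integral_sum has_bochner_integral_mult_right has_bochner_integral_real_indicator)
       (auto simp: emeasure_eq_measure)
  have "has_bochner_integral M (\<lambda>\<omega>. f (hist X n \<omega>)) (\<Sum>l\<in>paths n. f l * \<P>(\<omega> in M. hist X n \<omega> = l))"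
    using int by (subst has_bochner_integral_cong_AE[OF _ _ ae, symmetric]) auto
  then show ?I ?E
    by (auto simp: has_bochner_integral_iff)
qed

text \<open>The truncated \<open>hd l - 1\<close> at \<open>hd l = 0\<close> is harmless, since \<open>up_prob p 0 = 1\<close>.\<close>

definition avg :: "(nat list \<Rightarrow> real) \<Rightarrow> nat list \<Rightarrow> real" where
  "avg f l = up_prob p (hd l) * f (Suc (hd l) # l) + (1 - up_prob p (hd l)) * f ((hd l - 1) # l)"

text \<open>The Markov property in integrated form: each path splits into its up-step and down-step
  continuations, weighted by the transition probabilities.\<close>

lemma expectation_step:
  "expectation (\<lambda>\<omega>. f (hist X (Suc n) \<omega>)) = expectation (\<lambda>\<omega>. avg f (hist X n \<omega>))"
proof -
  let ?U = "\<lambda>l. {\<omega> \<in> space M. hist X n \<omega> = l \<and> X (Suc n) \<omega> = Suc (hd l)}"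
  let ?V = "\<lambda>l. {\<omega> \<in> space M. hist X n \<omega> = l \<and> Suc (X (Suc n) \<omega>) = hd l}"
  let ?g = "\<lambda>\<omega>. \<Sum>l\<in>paths n. f (Suc (hd l) # l) * indicator (?U l) \<omega> + f ((hd l - 1) # l) * indicator (?V l) \<omega>"
  have ae: "AE \<omega> in M. f (hist X (Suc n) \<omega>) = ?g \<omega>"
    using AE_hist_in_paths[of n] AE_step[of n] AE_space
  proof eventually_elim
    case (elim \<omega>)
    have "f (Suc (hd l) # l) * indicator (?U l) \<omega> + f ((hd l - 1) # l) * indicator (?V l) \<omega> =
        (if l = hist X n \<omega> then f (hist X (Suc n) \<omega>) else 0)" for l
    proof (cases "l = hist X n \<omega>")
      case True
      from elim(2) show ?thesis
      proof
        assume "X (Suc n) \<omega> = Suc (X n \<omega>)"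
        then show ?thesis using True elim(3) by (simp add: indicator_def)
      next
        assume *: "Suc (X (Suc n) \<omega>) = X n \<omega>"
        then have "X n \<omega> - 1 = X (Suc n) \<omega>" "X (Suc n) \<omega> \<noteq> Suc (X n \<omega>)" by auto
        with * show ?thesis using True elim(3) by (simp add: indicator_def)
      qed
    qed (auto simp: indicator_def)
    then have "?g \<omega> = (\<Sum>l\<in>paths n. if l = hist X n \<omega> then f (hist X (Suc n) \<omega>) else 0)"
      by (simp only:)
    also have "\<dots> = f (hist X (Suc n) \<omega>)" using elim by (simp add: finite_paths)
    finally show ?case by simp
  qed
  have "expectation (\<lambda>\<omega>. f (hist X (Suc n) \<omega>)) = expectation ?g"
    using ae by (intro integral_cong_AE) auto
  also have "\<dots> = (\<Sum>l\<in>paths n. f (Suc (hd l) # l) * prob (?U l) + f ((hd l - 1) # l) * prob (?V l))"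
    by (intro has_bochner_integral_integral_eq has_bochner_integral_sum has_bochner_integral_add
        has_bochner_integral_mult_right has_bochner_integral_real_indicator)
       (auto simp: emeasure_eq_measure)
  also have "\<dots> = expectation (\<lambda>\<omega>. avg f (hist X n \<omega>))"
    unfolding expectation_hist(2)[of "avg f"] prob_hist_up prob_hist_down
    by (auto simp: avg_def algebra_simps intro!: sum.cong)
  finally show ?thesis .
qed

end

subsection \<open>Transience and convergence of the series\<close>

text \<open>The terms of the series for D(R), the leading 1 being the term of index 0. Also,
  \<open>rho p 0 x\<close> is the increment from \<open>x\<close> to \<open>x + 1\<close> of the
  scale function of the walk.\<close>

definition rho :: "(nat \<Rightarrow> real) \<Rightarrow> nat \<Rightarrow> nat \<Rightarrow> real" where
  "rho p R j = (\<Prod>i=1..j. U_ratio p (R + i))"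

lemma rho_0 [simp]: "rho p R 0 = 1"
  by (simp add: rho_def)

lemma rho_Suc: "rho p R (Suc j) = U_ratio p (R + Suc j) * rho p R j"
  by (simp add: rho_def mult.commute)

lemma rho_shift: "rho p 0 (R + j) = rho p 0 R * rho p R j"
  by (induction j) (auto simp: rho_Suc)

context nn_walk
begin

lemma up_prob_ge_half: "1 / 2 \<le> up_prob p i"
  and up_prob_le_1: "up_prob p i \<le> 1"
  and U_ratio_pos: "1 \<le> i \<Longrightarrow> 0 < U_ratio p i"
  using p_range[of i] by (auto simp: up_prob_def U_ratio_def)

lemma up_prob_mult_U_ratio: "up_prob p i * U_ratio p i = 1 - up_prob p i"
  using up_prob_ge_half[of i] by (auto simp: U_ratio_def)

lemma rho_pos: "0 < rho p R j"
  unfolding rho_def by (intro prod_pos) (auto intro!: U_ratio_pos)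

text \<open>The martingale property on the event of a given past, which plays the role of the Markov
  property at time \<open>n\<close>. That event can be read off any later path by dropping entries,
  so each induction step is one use of \<open>expectation_step\<close>.\<close>

lemma expectation_harmonic:
  assumes "\<And>l'. l' \<noteq> [] \<Longrightarrow> avg g l' = g l'"
  shows "expectation (\<lambda>\<omega>. if hist X n \<omega> = l then g (hist X (n + k) \<omega>) else 0) =
    g l * \<P>(\<omega> in M. hist X n \<omega> = l)"
proof (induction k)
  case 0
  have "expectation (\<lambda>\<omega>. if hist X n \<omega> = l then g (hist X n \<omega>) else 0) =
      expectation (\<lambda>\<omega>. g l * indicator {\<omega> \<in> space M. hist X n \<omega> = l} \<omega>)"
    by (intro Bochner_Integration.integral_cong) auto
  then show ?case by (simp add: Int_def conj_commute cong: if_cong)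
next
  case (Suc k)
  let ?f = "\<lambda>k l'. if drop k l' = l then g l' else 0"
  have "expectation (\<lambda>\<omega>. if hist X n \<omega> = l then g (hist X (n + Suc k) \<omega>) else 0) =
      expectation (\<lambda>\<omega>. ?f (Suc k) (hist X (Suc (n + k)) \<omega>))"
    using drop_hist[of "Suc k" X n] by (simp cong: if_cong)
  also have "\<dots> = expectation (\<lambda>\<omega>. avg (?f (Suc k)) (hist X (n + k) \<omega>))"
    by (rule expectation_step)
  also have "\<dots> = expectation (\<lambda>\<omega>. ?f k (hist X (n + k) \<omega>))"
  proof (intro Bochner_Integration.integral_cong refl)
    fix \<omega>
    show "avg (?f (Suc k)) (hist X (n + k) \<omega>) = ?f k (hist X (n + k) \<omega>)"
      using assms[of "hist X (n + k) \<omega>"] by (simp add: avg_def)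
  qed
  finally show ?case using Suc by (simp add: drop_hist)
qed

lemma prob_hist_0: "\<P>(\<omega> in M. hist X 0 \<omega> = [0]) = 1"
  using X_0 by (subst prob_eq_1) auto

lemma expectation_harmonic_0:
  assumes "\<And>l. l \<noteq> [] \<Longrightarrow> avg g l = g l"
  shows "expectation (\<lambda>\<omega>. g (hist X k \<omega>)) = g [0]"
proof -
  have "expectation (\<lambda>\<omega>. g (hist X k \<omega>)) =
      expectation (\<lambda>\<omega>. if hist X 0 \<omega> = [0] then g (hist X (0 + k) \<omega>) else 0)"
  proof (rule integral_cong_AE)
    show "AE \<omega> in M. g (hist X k \<omega>) = (if hist X 0 \<omega> = [0] then g (hist X (0 + k) \<omega>) else 0)"
      using X_0 by eventually_elim simp
  qed auto
  also have "\<dots> = g [0]"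
    using expectation_harmonic[of g 0 "[0]" k] assms prob_hist_0 by simp
  finally show ?thesis .
qed

text \<open>\<open>survival n x\<close> is the probability that the walk started at \<open>x\<close> avoids \<open>0\<close> up to time \<open>n\<close>.\<close>

primrec survival :: "nat \<Rightarrow> nat \<Rightarrow> real" where
  "survival 0 x = (if x = 0 then 0 else 1)"
| "survival (Suc n) x = (if x = 0 then 0 else
     up_prob p x * survival n (Suc x) + (1 - up_prob p x) * survival n (x - 1))"

lemma survival_0 [simp]: "survival n 0 = 0"
  by (cases n) auto

lemma survival_bounds: "0 \<le> survival n x \<and> survival n x \<le> 1"
proof (induction n arbitrary: x)
  case (Suc n)
  have "up_prob p x * survival n (Suc x) + (1 - up_prob p x) * survival n (x - 1) \<le>
      up_prob p x * 1 + (1 - up_prob p x) * 1"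
    using Suc up_prob_le_1[of x] up_prob_ge_half[of x] by (intro add_mono mult_left_mono) auto
  then show ?case using Suc up_prob_le_1[of x] up_prob_ge_half[of x] by auto
qed auto

lemma survival_antimono: "survival (Suc n) x \<le> survival n x"
proof (induction n arbitrary: x)
  case 0
  show ?case using survival_bounds[of 1 x] by (cases "x = 0") auto
next
  case (Suc n)
  show ?case
  proof (cases "x = 0")
    case False
    have "up_prob p x * survival (Suc n) (Suc x) + (1 - up_prob p x) * survival (Suc n) (x - 1) \<le>
        up_prob p x * survival n (Suc x) + (1 - up_prob p x) * survival n (x - 1)"
      using up_prob_le_1[of x] up_prob_ge_half[of x]
      by (intro add_mono mult_left_mono Suc) (auto simp del: survival.simps)
    with False show ?thesis
      unfolding survival.simps(2)[of "Suc n" x] survival.simps(2)[of n x] by simp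
  qed simp
qed

lemma survival_limit:
  assumes "\<not> summable (rho p 0)"
  shows "(\<lambda>n. survival n 1) \<longlonglongrightarrow> 0"
proof -
  have "\<exists>L. (\<lambda>n. survival n x) \<longlonglongrightarrow> L" for x
    using survival_bounds[of _ x] survival_antimono[of _ x]
    by (intro exI[of _ "INF n. survival n x"] LIMSEQ_decseq_INF)
       (auto simp: decseq_Suc_iff bdd_below_def)
  then obtain Q where Q: "\<And>x. (\<lambda>n. survival n x) \<longlonglongrightarrow> Q x"
    by metis
  have Q0: "Q 0 = 0"
    using LIMSEQ_unique[OF Q[of 0]] by simp
  have Q_le: "Q x \<le> 1" for x
    using survival_bounds by (intro LIMSEQ_le_const2[OF Q[of x]]) auto
  have harm: "Q x = up_prob p x * Q (Suc x) + (1 - up_prob p x) * Q (x - 1)" if "x \<noteq> 0" for x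
  proof (rule LIMSEQ_unique)
    show "(\<lambda>n. survival (Suc n) x) \<longlonglongrightarrow> Q x"
      using Q by (rule LIMSEQ_Suc)
    show "(\<lambda>n. survival (Suc n) x) \<longlonglongrightarrow> up_prob p x * Q (Suc x) + (1 - up_prob p x) * Q (x - 1)"
      using that Q[of "Suc x"] Q[of "x - 1"] by (auto intro!: tendsto_intros)
  qed
  \<comment> \<open>Harmonicity at \<open>x\<close> says that consecutive increments of
    \<open>Q\<close> have ratio \<open>U_ratio p x\<close>, which is the recursion of
    \<open>rho p 0\<close>.\<close>
  have diff: "Q (Suc x) - Q x = rho p 0 x * Q 1" for x
  proof (induction x)
    case 0
    show ?case using Q0 by simp
  next
    case (Suc x)
    let ?u = "up_prob p (Suc x)"
    have "?u * (Q (Suc (Suc x)) - Q (Suc x)) = (1 - ?u) * (Q (Suc x) - Q x)"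
      using harm[of "Suc x"] by (simp add: algebra_simps)
    also have "\<dots> = ?u * (U_ratio p (Suc x) * (Q (Suc x) - Q x))"
      by (simp flip: up_prob_mult_U_ratio)
    finally show ?case
      using Suc up_prob_ge_half[of "Suc x"] by (simp add: rho_Suc)
  qed
  have Q_eq: "Q x = Q 1 * (\<Sum>j<x. rho p 0 j)" for x
  proof (induction x)
    case (Suc x)
    then show ?case using diff[of x] by (simp add: algebra_simps)
  qed (simp add: Q0)
  have "Q 1 = 0"
  proof (rule ccontr)
    assume "Q 1 \<noteq> 0"
    moreover have "0 \<le> Q 1"
      using survival_bounds by (intro LIMSEQ_le_const[OF Q[of 1]]) auto
    ultimately have pos: "0 < Q 1" by simp
    \<comment> \<open>A positive \<open>Q 1\<close> turns the bound \<open>Q x \<le> 1\<close> into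
      a bound on all partial sums.\<close>
    have "summable (rho p 0)"
    proof (rule summableI_nonneg_bounded)
      show "(\<Sum>j<x. rho p 0 j) \<le> 1 / Q 1" for x
        using Q_le[of x] pos Q_eq[of x] by (simp add: field_simps)
    qed (use rho_pos in \<open>auto intro: less_imp_le\<close>)
    with assms show False by simp
  qed
  with Q[of 1] show ?thesis by simp
qed

lemma set_butlast_hist: "set (butlast (hist X n \<omega>)) = (\<lambda>k. X k \<omega>) ` {1..n}"
  by (induction n) (auto simp: atLeastAtMostSuc_conv)

text \<open>A step of the walk uses up one unit of the remaining time \<open>j\<close>, and the
  expectation is conserved. \<open>butlast\<close> discards time 0, when the walk is at 0.\<close>

lemma expectation_survival:
  "expectation (\<lambda>\<omega>. if 0 \<notin> set (butlast (hist X (Suc k) \<omega>)) then survival j (X (Suc k) \<omega>) else 0) =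
   \<P>(\<omega> in M. 0 \<notin> set (butlast (hist X (Suc (k + j)) \<omega>)))"
proof (induction j arbitrary: k)
  case 0
  have "(if 0 \<notin> set (butlast (hist X (Suc k) \<omega>)) then survival 0 (X (Suc k) \<omega>) else 0) =
      indicat_real {\<omega>. 0 \<notin> set (butlast (hist X (Suc k) \<omega>))} \<omega>" for \<omega>
    by auto
  then show ?case by (simp add: Int_def conj_commute del: hist.simps)
next
  case (Suc j)
  let ?f = "\<lambda>j l. if 0 \<notin> set (butlast l) then survival j (hd l) else 0"
  have "expectation (\<lambda>\<omega>. ?f (Suc j) (hist X (Suc k) \<omega>)) =
      expectation (\<lambda>\<omega>. avg (?f j) (hist X (Suc k) \<omega>))"
  proof (intro Bochner_Integration.integral_cong refl)
    fix \<omega>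
    let ?l = "hist X (Suc k) \<omega>"
    show "?f (Suc j) ?l = avg (?f j) ?l"
      \<comment> \<open>From height 1 the down-step enters 0; it contributes nothing on either side,
        as \<open>survival j 0 = 0\<close>.\<close>
      by (cases "X (Suc k) \<omega> = 1") (auto simp: avg_def)
  qed
  also have "\<dots> = expectation (\<lambda>\<omega>. ?f j (hist X (Suc (Suc k)) \<omega>))"
    by (rule expectation_step[symmetric])
  also have "\<dots> = \<P>(\<omega> in M. 0 \<notin> set (butlast (hist X (Suc (k + Suc j)) \<omega>)))"
    using Suc[of "Suc k"] by (simp del: hist.simps cong: if_cong)
  finally show ?case by (simp del: hist.simps cong: if_cong)
qed

text \<open>The step from 0 to 1 is forced, so \<open>Suc j\<close> steps from 0 amount to
  \<open>j\<close> steps from 1.\<close>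

lemma prob_avoid_0: "\<P>(\<omega> in M. \<forall>n\<in>{1..Suc j}. X n \<omega> \<noteq> 0) = survival j 1"
proof -
  let ?f = "\<lambda>l. if 0 \<notin> set (butlast l) then survival j (hd l) else 0"
  have "\<P>(\<omega> in M. \<forall>n\<in>{1..Suc j}. X n \<omega> \<noteq> 0) = \<P>(\<omega> in M. 0 \<notin> set (butlast (hist X (Suc (0 + j)) \<omega>)))"
    unfolding set_butlast_hist by (intro arg_cong[where f=prob]) auto
  also have "\<dots> = expectation (\<lambda>\<omega>. ?f (hist X (Suc 0) \<omega>))"
    using expectation_survival[of 0 j] by (simp del: hist.simps cong: if_cong)
  also have "\<dots> = expectation (\<lambda>\<omega>. avg ?f (hist X 0 \<omega>))"
    by (rule expectation_step)
  also have "\<dots> = expectation (\<lambda>\<omega>. survival j 1)"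
  proof (rule integral_cong_AE)
    show "AE \<omega> in M. avg ?f (hist X 0 \<omega>) = survival j 1"
      using X_0 by eventually_elim (simp add: avg_def up_prob_def)
  qed auto
  finally show ?thesis by (simp add: prob_space)
qed

lemma transient_imp_summable:
  assumes "transient_walk M X"
  shows "summable (rho p R)"
proof -
  have "summable (rho p 0)"
  proof (rule ccontr)
    assume "\<not> summable (rho p 0)"
    then have lim: "(\<lambda>n. survival n 1) \<longlonglongrightarrow> 0" by (rule survival_limit)
    have "\<P>(\<omega> in M. \<forall>n>0. X n \<omega> \<noteq> 0) \<le> survival j 1" for j
      unfolding prob_avoid_0[symmetric] by (intro finite_measure_mono) auto
    then have "\<P>(\<omega> in M. \<forall>n>0. X n \<omega> \<noteq> 0) \<le> 0"
      by (intro LIMSEQ_le_const[OF lim]) auto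
    then have "\<P>(\<omega> in M. \<forall>n>0. X n \<omega> \<noteq> 0) = 0"
      by (simp add: measure_le_0_iff)
    then have "AE \<omega> in M. \<not> (\<forall>n>0. X n \<omega> \<noteq> 0)"
      by (subst (asm) prob_eq_0) (auto elim!: eventually_mono)
    with X_0 have "AE \<omega> in M. (\<exists>n>0. X n \<omega> = 0) \<and> X 0 \<omega> = 0"
      by eventually_elim auto
    then have "\<P>(\<omega> in M. (\<exists>n>0. X n \<omega> = 0) \<and> X 0 \<omega> = 0) = 1"
      by (subst prob_eq_1) auto
    moreover have "\<P>(\<omega> in M. X 0 \<omega> = 0) = 1"
      using X_0 by (subst prob_eq_1) auto
    ultimately show False
      using assms unfolding transient_walk_def transient_state_def cond_prob_def
      by (auto dest!: spec[of _ 0])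
  qed
  \<comment> \<open>The tail beyond \<open>R\<close> of the series at 0 is the series at
    \<open>R\<close> times the positive constant \<open>rho p 0 R\<close>.\<close>
  then have "summable (\<lambda>j. rho p 0 (R + j))"
    by (subst add.commute) (rule summable_ignore_initial_segment)
  then show ?thesis
    using rho_pos[of 0 R] by (simp add: rho_shift)
qed

end

subsection \<open>The law of the total local time\<close>

definition D_real :: "(nat \<Rightarrow> real) \<Rightarrow> nat \<Rightarrow> real" where
  "D_real p R = (\<Sum>j. rho p R j)"

text \<open>The probability of ever being at \<open>R\<close> from \<open>x\<close>. Truncated
  subtraction gives 1 up to \<open>R\<close>, where a visit is certain; above \<open>R\<close> it is
  the harmonic function with value 1 at \<open>R\<close> and limit 0 at infinity.\<close>

definition hit_prob :: "(nat \<Rightarrow> real) \<Rightarrow> nat \<Rightarrow> nat \<Rightarrow> real" where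
  "hit_prob p R x = 1 - (\<Sum>j<x - R. rho p R j) / D_real p R"

text \<open>A down-step from \<open>R\<close> is followed by a sure return; after an up-step the
  return fails with probability \<open>1 / D_real p R\<close>. This gives the subtracted escape
  probability.\<close>

definition return_prob :: "(nat \<Rightarrow> real) \<Rightarrow> nat \<Rightarrow> real" where
  "return_prob p R = 1 - up_prob p R / D_real p R"

text \<open>
  \<open>reach_prob p R N l\<close> is the conditional probability of at least \<open>N\<close> visits to \<open>R\<close> in total, given
  the path \<open>l\<close> so far (latest state first, and the visits in \<open>l\<close> counted).
\<close>

definition reach_prob :: "(nat \<Rightarrow> real) \<Rightarrow> nat \<Rightarrow> nat \<Rightarrow> nat list \<Rightarrow> real" where
  "reach_prob p R N l =
     (if N \<le> count_list l R then 1
      else if hd l = R then return_prob p R ^ (N - count_list l R)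
      else hit_prob p R (hd l) * return_prob p R ^ (N - Suc (count_list l R)))"

lemma hit_prob_le [simp]: "x \<le> R \<Longrightarrow> hit_prob p R x = 1"
  by (simp add: hit_prob_def)

section \<open>Hitting and return probabilities of a fixed level\<close>

locale transient_nn_walk = nn_walk +
  assumes transient: "transient_walk M X"
begin

lemma summable_rho: "summable (rho p R)"
  by (rule transient_imp_summable[OF transient])

lemma sum_rho_le: "(\<Sum>j<k. rho p R j) \<le> D_real p R"
  unfolding D_real_def using summable_rho rho_pos by (intro sum_le_suminf) (auto intro: less_imp_le)

lemma D_real_ge_1: "1 \<le> D_real p R"
  using sum_rho_le[of R 1] by simp

lemma D_inf_eq: "D_inf p R = ereal (D_real p R)"
proof -
  have "(\<lambda>j. rho p R (Suc j)) sums (D_real p R - 1)"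
    using summable_rho[of R] by (simp add: D_real_def sums_Suc_iff summable_sums)
  then have "(\<lambda>j. ereal (rho p R (Suc j))) sums ereal (D_real p R - 1)"
    by (simp add: sums_ereal)
  then have "(\<Sum>j. ereal (rho p R (Suc j))) = ereal (D_real p R - 1)"
    by (rule sums_unique[symmetric])
  then show ?thesis
    by (simp add: D_inf_def rho_def one_ereal_def)
qed

lemma hit_prob_nonneg: "0 \<le> hit_prob p R x"
  and hit_prob_le_1: "hit_prob p R x \<le> 1"
  using sum_rho_le[of R "x - R"] D_real_ge_1[of R] sum_nonneg[of "{..<x - R}" "rho p R"]
    less_imp_le[OF rho_pos]
  by (auto simp: hit_prob_def)

lemma hit_prob_tendsto_0: "hit_prob p R \<longlonglongrightarrow> 0"
proof (rule LIMSEQ_offset[where k=R])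
  have "(\<lambda>k. 1 - (\<Sum>j<k. rho p R j) / D_real p R) \<longlonglongrightarrow> 1 - D_real p R / D_real p R"
    using summable_LIMSEQ[OF summable_rho[of R]] D_real_ge_1[of R]
    unfolding D_real_def[symmetric] by (intro tendsto_intros) auto
  then show "(\<lambda>k. hit_prob p R (k + R)) \<longlonglongrightarrow> 0"
    using D_real_ge_1[of R] by (simp add: hit_prob_def)
qed

lemma hit_prob_step:
  "up_prob p x * hit_prob p R (Suc x) + (1 - up_prob p x) * hit_prob p R (x - 1) =
     (if x = R then return_prob p R else hit_prob p R x)"
proof -
  consider "x < R" | "x = R" | k where "x = R + Suc k"
    by (metis less_iff_Suc_add nat_neq_iff add_Suc_right)
  then show ?thesis
  proof cases
    case 3
    \<comment> \<open>The recursion of \<open>rho\<close> is exactly the balance of the weighted up-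
      and down-increments of the partial sums.\<close>
    have "up_prob p x * rho p R (Suc k) = (1 - up_prob p x) * rho p R k"
      using up_prob_mult_U_ratio[of x] by (simp add: rho_Suc 3 flip: mult.assoc)
    moreover define a b where "a = rho p R (Suc k) / D_real p R" and "b = rho p R k / D_real p R"
    ultimately have harm: "up_prob p x * a = (1 - up_prob p x) * b"
      by simp
    have "hit_prob p R (Suc x) = hit_prob p R x - a" "hit_prob p R (x - 1) = hit_prob p R x + b"
      by (simp_all add: 3 a_def b_def hit_prob_def add_divide_distrib Suc_diff_le)
    then have "up_prob p x * hit_prob p R (Suc x) + (1 - up_prob p x) * hit_prob p R (x - 1) =
        up_prob p x * (hit_prob p R x - a) + (1 - up_prob p x) * (hit_prob p R x + b)"
      by simp
    also have "\<dots> = hit_prob p R x"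
      using harm by (simp add: algebra_simps)
    finally show ?thesis using 3 by simp
  qed (auto simp: return_prob_def hit_prob_def[of p R "Suc R"] algebra_simps)
qed

lemma return_prob_nonneg: "0 \<le> return_prob p R"
  and return_prob_less_1: "return_prob p R < 1"
  using D_real_ge_1[of R] up_prob_ge_half[of R] up_prob_le_1[of R]
  by (auto simp: return_prob_def)

lemma reach_prob_bounds: "0 \<le> reach_prob p R N l \<and> reach_prob p R N l \<le> 1"
  using hit_prob_nonneg hit_prob_le_1 return_prob_nonneg[of R] return_prob_less_1[of R]
  by (auto simp: reach_prob_def intro!: mult_nonneg_nonneg mult_le_one power_le_one)

lemma reach_prob_harmonic:
  assumes "l \<noteq> []"
  shows "avg (reach_prob p R N) l = reach_prob p R N l"
proof (cases "N \<le> count_list l R")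
  case True
  then show ?thesis by (simp add: avg_def reach_prob_def)
next
  case False
  let ?a = "return_prob p R ^ (N - Suc (count_list l R))"
  \<comment> \<open>One formula covers both cases: for \<open>y = R\<close> the added visit lowers
    the number still missing by one, and \<open>hit_prob p R R = 1\<close>.\<close>
  have step: "reach_prob p R N (y # l) = hit_prob p R y * ?a" for y
    using False by (auto simp: reach_prob_def not_le le_Suc_eq)
  have "avg (reach_prob p R N) l =
      (up_prob p (hd l) * hit_prob p R (Suc (hd l)) + (1 - up_prob p (hd l)) * hit_prob p R (hd l - 1)) * ?a"
    unfolding avg_def step by (simp add: algebra_simps)
  also have "\<dots> = (if hd l = R then return_prob p R else hit_prob p R (hd l)) * ?a"
    by (simp only: hit_prob_step)
  also have "\<dots> = reach_prob p R N l"
    using False by (auto simp: reach_prob_def not_le Suc_diff_Suc simp flip: power_Suc)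
  finally show ?thesis .
qed

text \<open>\<open>reach_prob\<close> equals 1 once \<open>N\<close> visits have occurred, so it
  dominates the indicator, while its expectation keeps the initial value.\<close>

lemma prob_local_time_ge:
  assumes "1 \<le> N"
  shows "\<P>(\<omega> in M. \<exists>m. N \<le> local_time X R m \<omega>) \<le> return_prob p R ^ (N - 1)"
proof -
  let ?A = "\<lambda>m. {\<omega> \<in> space M. N \<le> local_time X R m \<omega>}"
  have le: "prob (?A m) \<le> return_prob p R ^ (N - 1)" for m
  proof -
    have "prob (?A m) = expectation (indicator (?A m))" by simp
    also have "\<dots> \<le> expectation (\<lambda>\<omega>. reach_prob p R N (hist X m \<omega>))"
    proof (rule integral_mono)
      show "indicator (?A m) \<omega> \<le> reach_prob p R N (hist X m \<omega>)" for \<omega>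
        using reach_prob_bounds[of R N "hist X m \<omega>"]
        by (auto simp: indicator_def reach_prob_def local_time_eq_count_list)
    qed (auto simp: expectation_hist emeasure_eq_measure intro!: integrable_real_indicator)
    also have "\<dots> = reach_prob p R N [0]"
      by (rule expectation_harmonic_0) (rule reach_prob_harmonic)
    \<comment> \<open>For \<open>R = 0\<close> the start is itself a visit; for \<open>R > 0\<close>
      the first visit is certain. Either way \<open>N - 1\<close> returns remain.\<close>
    also have "\<dots> = return_prob p R ^ (N - 1)"
      using assms by (auto simp: reach_prob_def)
    finally show ?thesis .
  qed
  have "(\<lambda>m. prob (?A m)) \<longlonglongrightarrow> prob (\<Union>m. ?A m)"
    by (intro finite_Lim_measure_incseq) (auto simp: incseq_def dest: local_time_mono[where X=X and x=R] intro: order_trans)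
  then have "prob (\<Union>m. ?A m) \<le> return_prob p R ^ (N - 1)"
    by (rule LIMSEQ_le_const2) (use le in auto)
  also have "(\<Union>m. ?A m) = {\<omega> \<in> space M. \<exists>m. N \<le> local_time X R m \<omega>}" by auto
  finally show ?thesis .
qed

section \<open>Escape to infinity\<close>

lemma AE_local_time_bounded: "AE \<omega> in M. \<exists>N. \<forall>m. local_time X R m \<omega> < N"
proof -
  let ?B = "{\<omega> \<in> space M. \<forall>N. \<exists>m. N \<le> local_time X R m \<omega>}"
  have "(\<lambda>N. return_prob p R ^ N) \<longlonglongrightarrow> 0"
    using return_prob_nonneg[of R] return_prob_less_1[of R] by (intro LIMSEQ_power_zero) auto
  moreover have "prob ?B \<le> return_prob p R ^ N" for N
  proof -
    have "prob ?B \<le> \<P>(\<omega> in M. \<exists>m. Suc N \<le> local_time X R m \<omega>)"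
      by (intro finite_measure_mono) auto
    also have "\<dots> \<le> return_prob p R ^ N"
      using prob_local_time_ge[of "Suc N" R] by simp
    finally show ?thesis .
  qed
  ultimately have "prob ?B \<le> 0"
    by (intro LIMSEQ_le_const[of _ 0]) auto
  then have "prob ?B = 0" by (simp add: measure_le_0_iff)
  then have "AE \<omega> in M. \<not> (\<forall>N. \<exists>m. N \<le> local_time X R m \<omega>)"
    by (subst (asm) prob_eq_0) (auto elim!: eventually_mono)
  then show ?thesis by eventually_elim (auto simp: not_le)
qed

lemma eventually_neq_if_local_time_bounded:
  assumes "\<And>m. local_time X R m \<omega> < N"
  shows "\<forall>\<^sub>F m in sequentially. X m \<omega> \<noteq> R"
proof (rule ccontr)
  assume "\<not> (\<forall>\<^sub>F m in sequentially. X m \<omega> \<noteq> R)"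
  then have "infinite {m. X m \<omega> = R}"
    by (simp add: cofinite_eq_sequentially[symmetric] eventually_cofinite)
  then obtain S where S: "finite S" "card S = N" "S \<subseteq> {m. X m \<omega> = R}"
    using infinite_arbitrarily_large by blast
  have "card S \<le> local_time X R (Max (insert 0 S)) \<omega>"
    unfolding local_time_def using S by (intro card_mono) auto
  with assms[of "Max (insert 0 S)"] S show False by simp
qed

lemma AE_tends_to_infinity: "AE \<omega> in M. filterlim (\<lambda>m. X m \<omega>) at_top sequentially"
proof -
  have "AE \<omega> in M. \<forall>R. \<exists>N. \<forall>m. local_time X R m \<omega> < N"
    by (subst AE_all_countable) (auto intro: AE_local_time_bounded)
  then show ?thesis
  proof eventually_elim
    case (elim \<omega>)
    show ?case unfolding filterlim_at_top
    proof
      fix Z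
      have "\<forall>\<^sub>F m in sequentially. \<forall>R\<in>{..<Z}. X m \<omega> \<noteq> R"
        using elim eventually_neq_if_local_time_bounded by (intro eventually_ball_finite ballI) blast+
      then show "\<forall>\<^sub>F m in sequentially. Z \<le> X m \<omega>"
        by eventually_elim (auto simp: not_less[symmetric])
    qed
  qed
qed

text \<open>On the event of the past \<open>l\<close>, \<open>reach_prob\<close> converges almost
  surely to the indicator of at least \<open>N\<close> visits, so dominated convergence yields an
  exact law. As \<open>l\<close> stays below \<open>R\<close>, the first visit is still to come and
  is certain.\<close>

lemma prob_hist_local_time_ge:
  assumes l: "l \<noteq> []" "\<And>x. x \<in> set l \<Longrightarrow> x < R" and N: "1 \<le> N"
  shows "\<P>(\<omega> in M. hist X n \<omega> = l \<and> (\<exists>m. N \<le> local_time X R m \<omega>)) =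
    return_prob p R ^ (N - 1) * \<P>(\<omega> in M. hist X n \<omega> = l)"
proof -
  let ?s = "\<lambda>k \<omega>. if hist X n \<omega> = l then reach_prob p R N (hist X (n + k) \<omega>) else 0"
  let ?A = "{\<omega> \<in> space M. hist X n \<omega> = l \<and> (\<exists>m. N \<le> local_time X R m \<omega>)}"
  have "count_list l R = 0"
    using l by (subst count_list_0_iff) auto
  moreover have "hd l < R" using l by auto
  ultimately have "reach_prob p R N l = return_prob p R ^ (N - 1)"
    using N by (simp add: reach_prob_def)
  then have E: "expectation (?s k) = return_prob p R ^ (N - 1) * \<P>(\<omega> in M. hist X n \<omega> = l)" for k
    by (simp add: expectation_harmonic[OF reach_prob_harmonic])
  have "(\<lambda>k. expectation (?s k)) \<longlonglongrightarrow> expectation (indicator ?A)"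
  proof (rule integral_dominated_convergence[where w="\<lambda>_. 1"])
    show "AE \<omega> in M. (\<lambda>k. ?s k \<omega>) \<longlonglongrightarrow> indicator ?A \<omega>"
      using AE_tends_to_infinity AE_space
    proof eventually_elim
      case (elim \<omega>)
      have inf: "filterlim (\<lambda>k. X (n + k) \<omega>) at_top sequentially"
        using filterlim_compose[OF elim(1) filterlim_add_const_nat_at_top, of n] by (simp add: add.commute)
      show ?case
      proof (cases "hist X n \<omega> = l")
        case True
        show ?thesis
        proof (cases "\<exists>m. N \<le> local_time X R m \<omega>")
          case ex: True
          then obtain m where m: "N \<le> local_time X R m \<omega>" by blast
          have "\<forall>\<^sub>F k in sequentially. ?s k \<omega> = 1"
            using eventually_ge_at_top[of m]
          proof eventually_elim
            case (elim k)
            then have "local_time X R m \<omega> \<le> local_time X R (n + k) \<omega>"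
              by (intro local_time_mono) simp
            with m True show ?case
              by (simp add: reach_prob_def local_time_eq_count_list)
          qed
          then have "(\<lambda>k. ?s k \<omega>) \<longlonglongrightarrow> 1" by (rule tendsto_eventually)
          then show ?thesis using True ex elim by (simp add: indicator_def)
        next
          case not_ex: False
          have "\<forall>\<^sub>F k in sequentially. R < X (n + k) \<omega>"
            using inf[unfolded filterlim_at_top, rule_format, of "Suc R"] by (simp add: Suc_le_eq)
          \<comment> \<open>With fewer than \<open>N\<close> visits and the walk above
            \<open>R\<close>, \<open>reach_prob\<close> is at most a hitting probability from a
            height that tends to infinity.\<close>
          then have ub: "\<forall>\<^sub>F k in sequentially. ?s k \<omega> \<le> hit_prob p R (X (n + k) \<omega>)"
          proof eventually_elim
            case (elim k)
            have "hit_prob p R (X (n + k) \<omega>) * return_prob p R ^ i \<le> hit_prob p R (X (n + k) \<omega>)" for i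
              using return_prob_nonneg[of R] return_prob_less_1[of R] hit_prob_nonneg
              by (intro mult_left_le power_le_one) auto
            then show ?case
              using elim True not_ex by (auto simp: reach_prob_def local_time_eq_count_list)
          qed
          have "(\<lambda>k. ?s k \<omega>) \<longlonglongrightarrow> 0"
          proof (rule tendsto_sandwich[OF _ ub tendsto_const])
            show "(\<lambda>k. hit_prob p R (X (n + k) \<omega>)) \<longlonglongrightarrow> 0"
              using filterlim_compose[OF hit_prob_tendsto_0 inf] .
          qed (use reach_prob_bounds in auto)
          then show ?thesis using not_ex by (simp add: indicator_def)
        qed
      qed (simp add: indicator_def)
    qed
    show "AE \<omega> in M. norm (?s k \<omega>) \<le> 1" for k
      using reach_prob_bounds by auto
  qed auto
  then show ?thesis
    by (simp add: E LIMSEQ_const_iff)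
qed

end

subsection \<open>Almost sure bounds\<close>

context transient_nn_walk
begin

lemma AE_total_local_time_upper:
  assumes "0 < \<epsilon>"
  shows "AE \<omega> in M. \<forall>\<^sub>F R in sequentially.
    total_local_time X R \<omega> \<le> ereal (2 * (1 + \<epsilon>) * D_real p R * ln (real R))"
proof -
  define t where "t R = 2 * (1 + \<epsilon>) * D_real p R * ln (real R)" for R
  define N where "N R = Suc (nat \<lfloor>t R\<rfloor>)" for R
  \<comment> \<open>Keeps the truncation by \<open>nat\<close> harmless; the case
    \<open>R = 0\<close> rests on the convention \<open>ln 0 = 0\<close>.\<close>
  have t_nonneg: "0 \<le> t R" for R
    using D_real_ge_1[of R] assms by (cases "R = 0") (auto simp: t_def)
  let ?A = "\<lambda>R. {\<omega> \<in> space M. \<exists>m. N R \<le> local_time X R m \<omega>}"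
  have bound: "prob (?A R) \<le> exp 1 * real R powr (- (1 + \<epsilon>))" if "1 \<le> R" for R
  proof -
    \<comment> \<open>The escape probability. \<open>1 - e \<le> exp (- e)\<close> makes the
      geometric tail exponential; the factor \<open>exp 1\<close> in the bound pays for rounding
      \<open>t R\<close>, since \<open>e \<le> 1\<close>.\<close>
    define e where "e = up_prob p R / D_real p R"
    have D: "1 \<le> D_real p R" by (rule D_real_ge_1)
    have e: "0 \<le> e" "e \<le> 1"
      using D up_prob_ge_half[of R] up_prob_le_1[of R] by (auto simp: e_def)
    have ln: "0 \<le> ln (real R)" using that by simp
    have "t R - 1 \<le> real (N R - 1)"
      unfolding N_def using t_nonneg[of R] by simp
    then have *: "e * (t R - 1) \<le> e * real (N R - 1)"
      using e by (intro mult_left_mono)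
    have "prob (?A R) \<le> return_prob p R ^ (N R - 1)"
      by (intro prob_local_time_ge) (simp add: N_def)
    also have "\<dots> \<le> exp (- e) ^ (N R - 1)"
      using return_prob_nonneg[of R] exp_ge_add_one_self[of "- e"]
      by (intro power_mono) (auto simp: return_prob_def e_def)
    also have "\<dots> = exp (- (e * real (N R - 1)))"
      by (simp add: exp_of_nat_mult[symmetric] mult.commute)
    also have "\<dots> \<le> exp (1 - (1 + \<epsilon>) * ln (real R))"
    proof -
      \<comment> \<open>The 2 in the threshold is spent here, against
        \<open>up_prob p R \<ge> 1/2\<close>.\<close>
      have "e * t R = (2 * up_prob p R) * ((1 + \<epsilon>) * ln (real R))"
        unfolding e_def t_def using D by (simp add: field_simps)
      also have "\<dots> \<ge> 1 * ((1 + \<epsilon>) * ln (real R))"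
        using up_prob_ge_half[of R] ln assms by (intro mult_right_mono) auto
      finally have "1 * ((1 + \<epsilon>) * ln (real R)) \<le> e * t R" .
      then show ?thesis using * e by (simp add: algebra_simps)
    qed
    also have "\<dots> = exp 1 * real R powr (- (1 + \<epsilon>))"
      using that by (simp add: powr_def algebra_simps flip: exp_add)
    finally show ?thesis .
  qed
  have "summable (\<lambda>R. prob (?A R))"
  proof (rule summable_comparison_test')
    show "summable (\<lambda>R. exp 1 * real R powr (- (1 + \<epsilon>)))"
      using assms by (intro summable_mult) (simp add: summable_real_powr_iff)
    show "norm (prob (?A R)) \<le> exp 1 * real R powr (- (1 + \<epsilon>))" if "1 \<le> R" for R
      using bound[OF that] by simp
  qed
  then have "AE \<omega> in M. \<forall>\<^sub>F R in sequentially. \<omega> \<in> space M - ?A R"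
    by (intro borel_cantelli_AE1) (auto simp: emeasure_eq_measure)
  then show ?thesis
  proof eventually_elim
    case (elim \<omega>)
    then show ?case
    proof eventually_elim
      case (elim R)
      then have *: "local_time X R m \<omega> < N R" for m by (auto simp: not_le)
      show ?case unfolding total_local_time_eq_SUP t_def[symmetric]
      proof (intro SUP_least)
        fix m
        have "local_time X R m \<omega> \<le> nat \<lfloor>t R\<rfloor>" using *[of m] by (simp add: N_def)
        then have "real (local_time X R m \<omega>) \<le> real (nat \<lfloor>t R\<rfloor>)" by simp
        also have "\<dots> \<le> t R" by (rule of_nat_floor[OF t_nonneg])
        finally show "ereal (real (local_time X R m \<omega>)) \<le> ereal (t R)" by simp
      qed
    qed
  qed
qed

section \<open>Lower bound at infinitely many levels\<close>

lemma D_real_ge_2: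
  assumes "p \<longlonglongrightarrow> 0"
  shows "\<forall>\<^sub>F R in sequentially. 2 \<le> D_real p R"
proof -
  \<comment> \<open>Below 1/40 the ratio exceeds 19/21 > 9/10, and then three terms of the series
    already exceed 2.\<close>
  have "\<forall>\<^sub>F i in sequentially. p i < 1 / 40"
    using assms by (intro order_tendstoD(2)) auto
  then obtain m where m: "\<And>i. m \<le> i \<Longrightarrow> p i < 1 / 40"
    by (auto simp: eventually_sequentially)
  show ?thesis
    using eventually_ge_at_top[of m]
  proof eventually_elim
    case (elim R)
    have U: "9 / 10 \<le> U_ratio p i" if "R < i" for i
      using m[of i] p_range[of i] that elim by (simp add: U_ratio_def up_prob_def field_simps)
    have "2 \<le> 1 + 9 / 10 + 9 / 10 * (9 / 10 :: real)" by simp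
    also have "\<dots> \<le> 1 + U_ratio p (R + 1) + U_ratio p (R + 2) * U_ratio p (R + 1)"
      using U[of "R + 1"] U[of "R + 2"] by (intro add_mono mult_mono) auto
    also have "\<dots> = (\<Sum>j<3. rho p R j)"
      by (simp add: eval_nat_numeral rho_Suc)
    also have "\<dots> \<le> D_real p R" by (rule sum_rho_le)
    finally show ?case .
  qed
qed

text \<open>On this range \<open>(1 - x) * (1 + 2 * x) = 1 + x * (1 - 2 * x) \<ge> 1\<close>. It is
  applied to \<open>x = 1 / D_real p R\<close>, whence the interest in
  \<open>2 \<le> D_real p R\<close>.\<close>

lemma exp_le_one_minus:
  fixes x :: real
  assumes "0 \<le> x" "x \<le> 1 / 2"
  shows "exp (- 2 * x) \<le> 1 - x"
proof -
  have "x * x \<le> x * (1 / 2)" using assms by (intro mult_left_mono) auto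
  then have "1 \<le> (1 - x) * (1 + 2 * x)" by (simp add: algebra_simps)
  also have "\<dots> \<le> (1 - x) * exp (2 * x)"
    using exp_ge_add_one_self[of "2 * x"] assms by (intro mult_left_mono) auto
  finally show ?thesis by (simp add: exp_minus field_simps)
qed

text \<open>
  In the proof, \<open>?G\<close> is the decreasing limit of the events \<open>?G' n\<close>, each determined by the first
  \<open>n\<close> steps, so \<open>prob ?G \<le> (1 - exp (-2 K)) * prob (?G' n)\<close> for all \<open>n\<close> yields \<open>prob ?G = 0\<close>
  without any zero-one law.
\<close>

lemma AE_total_local_time_lower:
  assumes p: "p \<longlonglongrightarrow> 0" and K: "0 < K"
  shows "AE \<omega> in M. \<exists>\<^sub>\<infinity>R. ereal (K * D_real p R) \<le> total_local_time X R \<omega>"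
proof -
  define N where "N R = nat \<lceil>K * D_real p R\<rceil>" for R
  define c where "c = exp (- 2 * K)"
  have c: "0 < c" by (simp add: c_def)
  have N_pos: "1 \<le> N R" for R
    using K D_real_ge_1[of R] by (simp add: N_def Suc_le_eq)
  have return: "c \<le> return_prob p R ^ (N R - 1)" if "2 \<le> D_real p R" for R
  proof -
    \<comment> \<open>\<open>return_prob p R \<ge> 1 - x\<close>, and
      \<open>N R - 1 \<le> K * D_real p R\<close> because a ceiling exceeds its argument by less
      than 1; so the exponent of \<open>exp (- 2 * x)\<close> costs at most
      \<open>2 * K\<close>.\<close>
    define x where "x = 1 / D_real p R"
    have x: "0 \<le> x" "x \<le> 1 / 2" using that by (auto simp: x_def)
    have "real (N R - 1) \<le> K * D_real p R"
      using K D_real_ge_1[of R] N_pos[of R] unfolding N_def by (simp add: of_nat_diff)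
    then have "x * real (N R - 1) \<le> x * (K * D_real p R)"
      using x by (intro mult_left_mono)
    also have "\<dots> = K" using that by (simp add: x_def)
    finally have "c \<le> exp (- 2 * x * real (N R - 1))"
      unfolding c_def by simp
    also have "\<dots> = exp (- 2 * x) ^ (N R - 1)"
      by (simp add: exp_of_nat_mult[symmetric] mult_ac)
    also have "\<dots> \<le> (1 - x) ^ (N R - 1)"
      using exp_le_one_minus[OF x] by (intro power_mono) auto
    also have "\<dots> \<le> return_prob p R ^ (N R - 1)"
      using x up_prob_le_1[of R] that
      by (intro power_mono) (auto simp: return_prob_def x_def divide_right_mono)
    finally show ?thesis .
  qed
  have null: "AE \<omega> in M. \<exists>R\<ge>r. \<exists>m. N R \<le> local_time X R m \<omega>" for r
  proof -
    let ?G = "{\<omega> \<in> space M. \<forall>R\<ge>r. \<forall>m. local_time X R m \<omega> < N R}"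
    let ?G' = "\<lambda>n. {\<omega> \<in> space M. \<forall>R\<ge>r. local_time X R n \<omega> < N R}"
    let ?H = "\<lambda>n l. {\<omega> \<in> space M. hist X n \<omega> = l}"
    have path: "prob (?G \<inter> ?H n l) \<le> (1 - c) * prob (?G' n \<inter> ?H n l)" if "l \<noteq> []" for n l
    proof (cases "\<forall>R\<ge>r. count_list l R < N R")
      case True
      have "\<forall>\<^sub>F R in sequentially. 2 \<le> D_real p R \<and> r \<le> R \<and> Max (set l) < R"
        by (intro eventually_conj D_real_ge_2 p eventually_ge_at_top eventually_gt_at_top)
      \<comment> \<open>\<open>R\<close> lies above all of \<open>l\<close>, so the exact
        conditional law applies: given \<open>l\<close>, the forbidden \<open>N R\<close> visits
        occur with probability at least \<open>c\<close>.\<close>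
      then obtain R where R: "2 \<le> D_real p R" "r \<le> R" "Max (set l) < R"
        by (auto dest: eventually_happens)
      let ?B = "{\<omega> \<in> space M. hist X n \<omega> = l \<and> (\<exists>m. N R \<le> local_time X R m \<omega>)}"
      have "prob (?G \<inter> ?H n l) \<le> prob (?H n l - ?B)"
        using R(2) by (intro finite_measure_mono) (auto simp: not_le[symmetric])
      also have "\<dots> = prob (?H n l) - prob ?B"
        by (intro finite_measure_Diff) auto
      also have "prob ?B = return_prob p R ^ (N R - 1) * prob (?H n l)"
        using R(3) that by (intro prob_hist_local_time_ge N_pos) auto
      also have "prob (?H n l) - \<dots> \<le> (1 - c) * prob (?H n l)"
        using return[OF R(1)] by (simp add: algebra_simps mult_right_mono)
      finally have "prob (?G \<inter> ?H n l) \<le> (1 - c) * prob (?H n l)" .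
      moreover have "?G' n \<inter> ?H n l = ?H n l"
        using True by (auto simp: local_time_eq_count_list)
      ultimately show ?thesis by simp
    next
      \<comment> \<open>Here \<open>l\<close> already contains \<open>N R\<close> visits to some
        \<open>R \<ge> r\<close>, which \<open>?G\<close> rules out.\<close>
      case False
      then have "?G \<inter> ?H n l = {}"
        by (auto simp: local_time_eq_count_list)
      then show ?thesis by (simp add: c_def K less_imp_le)
    qed
    have decompose: "prob S = (\<Sum>l\<in>paths n. prob (S \<inter> ?H n l))" if [measurable]: "S \<in> events" for S n
    proof -
      have "prob S = prob (\<Union>l\<in>paths n. S \<inter> ?H n l)"
        using AE_hist_in_paths[of n] finite_paths[of n]
        by (intro finite_measure_eq_AE) (auto elim!: eventually_mono)
      also have "\<dots> = (\<Sum>l\<in>paths n. prob (S \<inter> ?H n l))"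
        using finite_paths[of n]
        by (intro finite_measure_finite_Union) (auto simp: disjoint_family_on_def)
      finally show ?thesis .
    qed
    have step: "prob ?G \<le> (1 - c) * prob (?G' n)" for n
    proof -
      have "prob ?G = (\<Sum>l\<in>paths n. prob (?G \<inter> ?H n l))"
        by (rule decompose) measurable
      also have "\<dots> \<le> (\<Sum>l\<in>paths n. (1 - c) * prob (?G' n \<inter> ?H n l))"
        by (intro sum_mono path) (auto simp: paths_def)
      also have "\<dots> = (1 - c) * (\<Sum>l\<in>paths n. prob (?G' n \<inter> ?H n l))"
        by (simp add: sum_distrib_left)
      also have "(\<Sum>l\<in>paths n. prob (?G' n \<inter> ?H n l)) = prob (?G' n)"
        by (rule decompose[symmetric]) measurable
      finally show ?thesis .
    qed
    have "(\<lambda>n. prob (?G' n)) \<longlonglongrightarrow> prob (\<Inter>n. ?G' n)"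
      by (intro finite_Lim_measure_decseq)
         (auto simp: decseq_def intro: le_less_trans local_time_mono)
    moreover have "(\<Inter>n. ?G' n) = ?G" by auto
    ultimately have "(\<lambda>n. (1 - c) * prob (?G' n)) \<longlonglongrightarrow> (1 - c) * prob ?G"
      by (intro tendsto_mult_left) simp
    then have "prob ?G \<le> (1 - c) * prob ?G"
      by (rule LIMSEQ_le_const) (use step in auto)
    then have "c * prob ?G \<le> 0"
      by (simp add: algebra_simps)
    then have "prob ?G = 0"
      using c by (simp add: mult_le_0_iff measure_le_0_iff)
    then show ?thesis
      by (subst (asm) prob_eq_0) (auto elim!: eventually_mono simp: not_less)
  qed
  have "AE \<omega> in M. \<forall>r. \<exists>R\<ge>r. \<exists>m. N R \<le> local_time X R m \<omega>"
    by (subst AE_all_countable) (use null in blast)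
  then show ?thesis
  proof eventually_elim
    case (elim \<omega>)
    show ?case unfolding INFM_nat_le
    proof
      fix r
      obtain R m where R: "r \<le> R" "N R \<le> local_time X R m \<omega>" using elim by blast
      have "K * D_real p R \<le> real (N R)"
        unfolding N_def by (rule real_nat_ceiling_ge)
      also have "\<dots> \<le> real (local_time X R m \<omega>)" using R by simp
      finally have "ereal (K * D_real p R) \<le> ereal (real (local_time X R m \<omega>))" by simp
      also have "\<dots> \<le> total_local_time X R \<omega>"
        unfolding total_local_time_eq_SUP by (rule SUP_upper) simp
      finally show "\<exists>R\<ge>r. ereal (K * D_real p R) \<le> total_local_time X R \<omega>" using R by blast
    qed
  qed
qed

end

theorem theorem3p2:
  fixes M :: "'a measure" and p :: "nat \<Rightarrow> real" and X :: "nat \<Rightarrow> 'a \<Rightarrow> nat"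
  assumes "nn_walk M p X"
    and "transient_walk M X"
    and "p \<longlonglongrightarrow> 0"
  shows "(AE \<omega> in M. \<forall>\<epsilon>::real. \<epsilon> > 0 \<longrightarrow>
            (\<forall>\<^sub>F R in sequentially.
               total_local_time X R \<omega> \<le> ereal (2 * (1 + \<epsilon>)) * D_inf p R * ereal (ln (real R))))
         \<and> (\<forall>K::real. K > 0 \<longrightarrow>
              (AE \<omega> in M. \<exists>\<^sub>\<infinity>R. total_local_time X R \<omega> \<ge> ereal K * D_inf p R))"
proof -
  interpret transient_nn_walk M p X
    using assms by (simp add: transient_nn_walk_def transient_nn_walk_axioms_def)
  \<comment> \<open>The tolerances \<open>1 / (k + 1)\<close> form a countable family, so a single
    null set serves every \<epsilon>.\<close>
  have "AE \<omega> in M. \<forall>k. \<forall>\<^sub>F R in sequentially.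
      total_local_time X R \<omega> \<le> ereal (2 * (1 + 1 / real (Suc k)) * D_real p R * ln (real R))"
    by (subst AE_all_countable, intro allI AE_total_local_time_upper) simp
  then have "AE \<omega> in M. \<forall>\<epsilon>>0. \<forall>\<^sub>F R in sequentially.
      total_local_time X R \<omega> \<le> ereal (2 * (1 + \<epsilon>) * D_real p R * ln (real R))"
  proof eventually_elim
    case (elim \<omega>)
    show ?case
    proof (intro allI impI)
      fix \<epsilon> :: real
      assume "0 < \<epsilon>"
      then obtain k where k: "1 / real (Suc k) < \<epsilon>"
        using nat_approx_posE by blast
      show "\<forall>\<^sub>F R in sequentially.
          total_local_time X R \<omega> \<le> ereal (2 * (1 + \<epsilon>) * D_real p R * ln (real R))"
        \<comment> \<open>\<open>R \<ge> 1\<close> makes the logarithm nonnegative, so the bound is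
          monotone in the tolerance.\<close>
        using elim[rule_format, of k] eventually_ge_at_top[of 1]
      proof eventually_elim
        case (elim R)
        have "2 * (1 + 1 / real (Suc k)) * D_real p R * ln (real R) \<le> 2 * (1 + \<epsilon>) * D_real p R * ln (real R)"
          using k elim(2) D_real_ge_1[of R] by (intro mult_right_mono) auto
        with elim(1) show ?case by (meson ereal_less_eq(3) order_trans)
      qed
    qed
  qed
  then show ?thesis
    using AE_total_local_time_lower[OF assms(3)] by (simp add: D_inf_eq)
qed

end
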